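(* Let $\{A_n\}_{n\geqslant 1}$ be i.i.d. nonnegative random variables with Laplace–Stieltjes transform $\alpha(s)=\mathbb{E}[e^{-sA_1}]$, and let $\{B_n\}_{n\geqslant 1}$ be i.i.d. Erlang distributed with $N$ phases and rate $\mu>0$, independent of $\{A_n\}$. Let $W_1=0$ and $W_{n+1}=\max\{0,\,B_{n+1}-A_n-W_n\}$ for $n\geqslant 1$, and let $C=\inf\{k\geqslant 1: W_{1+k}=0\}$. Define, for $i,j\in\{1,\dots,N\}$, $$p_{ij}=\frac{(-\mu)^{N-j}}{2^i}\sum_{\ell=0}^{N-j}\binom{i+\ell-1}{i-1}\frac{\alpha^{(N-j-\ell)}(\mu)}{(N-j-\ell)!}\left(-\frac{1}{2\mu}\right)^{\ell},\qquad p_{0j}=\frac{(-\mu)^{N-j}}{(N-j)!}\alpha^{(N-j)}(\mu).$$ Let $\mathbf Q=(p_{ij})_{i,j=1}^N$, let $\mathbf q=(p_{01},\dots,p_{0N})$ (a row vector), let $\mathbf I$ be the $N\times N$ identity matrix and $\mathbf e$ the $N\times 1$ vector of ones. Then for every $n\geqslant 1$, $$\mathbb{P}[C=n+1]=\mathbf q\,\mathbf Q^{\,n-1}(\mathbf I-\mathbf Q)\,\mathbf e.$$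
   Context: $\alpha^{(m)}$ denotes the $m$-th derivative of $\alpha$. The numbers $p_{ij}$ are the transition probabilities of the Markov chain $F_n$ = number of remaining exponential preparation phases at the moment the $n$-th waiting time starts (state $0$ corresponding to $W_n=0$). *)

theory Defs
  imports "HOL-Probability.Probability" "Jordan_Normal_Form.Matrix"
begin

text \<open>Waiting times: index 0 is a dummy; W 1 = 0 and
  W (n+1) = max 0 (B (n+1) - A n - W n) for n >= 1.\<close>
primrec waiting :: "(nat \<Rightarrow> 'a \<Rightarrow> real) \<Rightarrow> (nat \<Rightarrow> 'a \<Rightarrow> real) \<Rightarrow> nat \<Rightarrow> 'a \<Rightarrow> real" where
  "waiting A B 0 \<omega> = 0"
| "waiting A B (Suc n) \<omega> =
     (if n = 0 then 0 else max 0 (B (Suc n) \<omega> - A n \<omega> - waiting A B n \<omega>))"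

text \<open>C = inf {k >= 1. W (1+k) = 0}, with inf of the empty set = infinity.\<close>
definition cycle_len :: "(nat \<Rightarrow> 'a \<Rightarrow> real) \<Rightarrow> (nat \<Rightarrow> 'a \<Rightarrow> real) \<Rightarrow> 'a \<Rightarrow> enat" where
  "cycle_len A B \<omega> = Inf {enat k | k. k \<ge> 1 \<and> waiting A B (1 + k) \<omega> = 0}"

definition trans_p :: "(real \<Rightarrow> real) \<Rightarrow> real \<Rightarrow> nat \<Rightarrow> nat \<Rightarrow> nat \<Rightarrow> real" where
  "trans_p \<alpha> \<mu> N i j =
    (if i = 0 then (-\<mu>) ^ (N - j) / fact (N - j) * (deriv ^^ (N - j)) \<alpha> \<mu>
     else (-\<mu>) ^ (N - j) / 2 ^ i *
       (\<Sum>l = 0..N - j. real ((i + l - 1) choose (i - 1)) *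
          ((deriv ^^ (N - j - l)) \<alpha> \<mu> / fact (N - j - l)) * (- 1 / (2 * \<mu>)) ^ l))"

end

theory Submission
  imports Defs
begin

text \<open>
  Let w m y = exp (- \<mu> y) (\<mu> y) ^ m / m! be the Poisson weights. They satisfy the convolution identity
  w m (x + y) = (\<Sum>l\<le>m. w l x * w (m - l) y), and an Erlang density with m + 1 phases is \<mu> * w m on the
  half-line. Hence the part of an Erlang preparation time with k + 1 phases that exceeds y is a mixture
  of Erlang laws: it has j + 1 phases left with weight w (k - j) y. Take y = A + W with W a mixture of
  Erlang laws. The convolution identity factors the new weights into the expectations of w m A, which
  are derivatives of the transform \<alpha> at \<mu>, and the integrals of w l against Erlang densities, which are
  binomial coefficients over powers of 2; the products are exactly the p i j. So the waiting times that
  have not yet reached 0 have phase distribution q, q Q, q Q^2, ..., and P(C > n) = q Q^(n-1) e.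
\<close>

section \<open>Uniform bounds for powers times exponentials\<close>

lemma power_div_fact_le_exp:
  fixes x :: real
  assumes "0 \<le> x"
  shows "x ^ m / fact m \<le> exp x"
proof -
  have "(\<Sum>n\<in>{m}. x ^ n /\<^sub>R fact n) \<le> (\<Sum>n. x ^ n /\<^sub>R fact n)"
    by (rule sum_le_suminf) (use assms summable_exp[of x] in \<open>auto simp: mult.commute\<close>)
  then show ?thesis
    by (simp add: exp_def field_simps)
qed

text \<open>The bound does not depend on \<open>x\<close>. For \<open>s > 0\<close> it makes
  \<open>X ^ m * exp (- s * X)\<close> integrable for every nonnegative random variable
  \<open>X\<close>, without any moment assumption.\<close>

lemma power_mult_exp_le:
  fixes x c :: real
  assumes "0 \<le> x" "0 < c"
  shows "x ^ m * exp (- c * x) \<le> fact m / c ^ m"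
  using power_div_fact_le_exp[of "c * x" m] assms
  by (simp add: exp_minus field_simps power_mult_distrib)

text \<open>Mean value inequality on \<open>{s / 2..}\<close>, which contains both \<open>s\<close>
  and \<open>s + h\<close>. The bound is free of \<open>h\<close>, so it can dominate all difference
  quotients at once.\<close>

lemma exp_difference_quotient_bound:
  fixes x s h :: real
  assumes "0 \<le> x" "\<bar>h\<bar> \<le> s / 2"
  shows "\<bar>(exp (- (s + h) * x) - exp (- s * x)) / h\<bar> \<le> x * exp (- (s / 2) * x)"
proof -
  have "norm (exp (- (s + h) * x) - exp (- s * x)) \<le> (x * exp (- (s / 2) * x)) * norm ((s + h) - s)"
  proof (rule field_differentiable_bound[where S = "{s / 2..}" and f = "\<lambda>t. exp (- t * x)"
        and f' = "\<lambda>t. - x * exp (- t * x)"])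
    fix t assume "t \<in> {s / 2..}"
    show "((\<lambda>t. exp (- t * x)) has_field_derivative - x * exp (- t * x)) (at t within {s / 2..})"
      by (auto intro!: derivative_eq_intros)
    have "s / 2 * x \<le> t * x"
      using assms \<open>t \<in> {s / 2..}\<close> by (intro mult_right_mono) auto
    then show "norm (- x * exp (- t * x)) \<le> x * exp (- (s / 2) * x)"
      using assms by (auto simp: abs_mult intro!: mult_left_mono)
  qed (use assms in \<open>auto simp: abs_if field_simps split: if_splits\<close>)
  \<comment> \<open>For \<open>h = 0\<close> the quotient is 0 by the convention on division, and
    only nonnegativity of the bound is left.\<close>
  with assms show ?thesis
    by (cases "h = 0") (auto simp: field_simps)
qed

section \<open>Derivatives of a Laplace transform\<close>

context prob_space
begin

lemma integrable_power_exp: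
  fixes X :: "'a \<Rightarrow> real"
  assumes [measurable]: "X \<in> borel_measurable M" and "AE \<omega> in M. 0 \<le> X \<omega>" "0 < s"
  shows "integrable M (\<lambda>\<omega>. X \<omega> ^ m * exp (- s * X \<omega>))"
proof (rule integrable_const_bound[where B = "fact m / s ^ m"])
  show "AE \<omega> in M. norm (X \<omega> ^ m * exp (- s * X \<omega>)) \<le> fact m / s ^ m"
    using assms(2)
  proof eventually_elim
    case (elim \<omega>)
    then show ?case using power_mult_exp_le[OF elim \<open>0 < s\<close>, of m] by simp
  qed
qed measurable

text \<open>Differentiation under the expectation by dominated convergence, with the integrable
  majorant \<open>X ^ Suc m * exp (- (s / 2) * X)\<close>.\<close>

lemma deriv_power_exp_expectation:
  fixes X :: "'a \<Rightarrow> real"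
  assumes [measurable]: "X \<in> borel_measurable M" and nn: "AE \<omega> in M. 0 \<le> X \<omega>" and s: "0 < s"
  shows "((\<lambda>s. expectation (\<lambda>\<omega>. X \<omega> ^ m * exp (- s * X \<omega>))) has_real_derivative
    - expectation (\<lambda>\<omega>. X \<omega> ^ Suc m * exp (- s * X \<omega>))) (at s)"
proof -
  define F where "F m s = expectation (\<lambda>\<omega>. X \<omega> ^ m * exp (- s * X \<omega>))" for m s
  have "((\<lambda>h. (F m (s + h) - F m s) / h) \<longlongrightarrow> - F (Suc m) s) (at 0)"
    \<comment> \<open>Dominated convergence speaks of sequences, so the limit is tested along null
      sequences avoiding 0.\<close>
    unfolding tendsto_at_iff_sequentially o_def
  proof (intro allI impI)
    fix h :: "nat \<Rightarrow> real" assume h: "\<forall>i. h i \<in> UNIV - {0}" "h \<longlonglongrightarrow> 0"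
    \<comment> \<open>The majorant needs \<open>h i\<close> within \<open>s / 2\<close> of 0. This
      holds only from some \<open>i0\<close> on, hence the shift by \<open>i0\<close> below.\<close>
    have "eventually (\<lambda>i. dist (h i) 0 < s / 2) sequentially"
      using h(2) s by (intro tendstoD) auto
    then obtain i0 where i0: "\<And>i. i \<ge> i0 \<Longrightarrow> \<bar>h i\<bar> < s / 2"
      by (auto simp: eventually_sequentially)
    let ?D = "\<lambda>i \<omega>. X \<omega> ^ m * ((exp (- (s + h i) * X \<omega>) - exp (- s * X \<omega>)) / h i)"
    have "(\<lambda>i. expectation (?D (i + i0))) \<longlonglongrightarrow> expectation (\<lambda>\<omega>. - (X \<omega> ^ Suc m * exp (- s * X \<omega>)))"
    proof (rule integral_dominated_convergence[where w = "\<lambda>\<omega>. X \<omega> ^ Suc m * exp (- (s / 2) * X \<omega>)"])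
      show "integrable M (\<lambda>\<omega>. X \<omega> ^ Suc m * exp (- (s / 2) * X \<omega>))"
        using nn s by (intro integrable_power_exp) auto
      have "(\<lambda>i. ?D i \<omega>) \<longlonglongrightarrow> - (X \<omega> ^ Suc m * exp (- s * X \<omega>))" for \<omega>
      proof -
        have "((\<lambda>t. exp (- t * X \<omega>)) has_real_derivative - X \<omega> * exp (- s * X \<omega>)) (at s)"
          by (auto intro!: derivative_eq_intros)
        then have "(\<lambda>i. (exp (- (s + h i) * X \<omega>) - exp (- s * X \<omega>)) / h i)
            \<longlonglongrightarrow> - X \<omega> * exp (- s * X \<omega>)"
          unfolding DERIV_def tendsto_at_iff_sequentially o_def using h by blast
        then have "(\<lambda>i. ?D i \<omega>) \<longlonglongrightarrow> X \<omega> ^ m * (- X \<omega> * exp (- s * X \<omega>))"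
          by (intro tendsto_intros)
        then show ?thesis by (simp add: mult_ac)
      qed
      then show "AE \<omega> in M. (\<lambda>i. ?D (i + i0) \<omega>) \<longlonglongrightarrow> - (X \<omega> ^ Suc m * exp (- s * X \<omega>))"
        by (intro AE_I2 LIMSEQ_ignore_initial_segment)
      show "AE \<omega> in M. norm (?D (i + i0) \<omega>) \<le> X \<omega> ^ Suc m * exp (- (s / 2) * X \<omega>)" for i
        using nn
      proof eventually_elim
        case (elim \<omega>)
        have "\<bar>X \<omega> ^ m\<bar> * \<bar>(exp (- (s + h (i + i0)) * X \<omega>) - exp (- s * X \<omega>)) / h (i + i0)\<bar>
            \<le> X \<omega> ^ m * (X \<omega> * exp (- (s / 2) * X \<omega>))"
          using elim i0[of "i + i0"]
          by (intro mult_mono exp_difference_quotient_bound) auto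
        then show ?case by (simp only: real_norm_def abs_mult power_Suc mult_ac)
      qed
    qed measurable
    then have "(\<lambda>i. expectation (?D i)) \<longlonglongrightarrow> expectation (\<lambda>\<omega>. - (X \<omega> ^ Suc m * exp (- s * X \<omega>)))"
      by (rule LIMSEQ_offset)
    then have "(\<lambda>i. expectation (?D i)) \<longlonglongrightarrow> - F (Suc m) s"
      by (simp add: F_def)
    moreover have "eventually (\<lambda>i. expectation (?D i) = (F m (s + h i) - F m s) / h i) sequentially"
      unfolding eventually_sequentially
    proof (intro exI allI impI)
      fix i assume "i \<ge> i0"
      \<comment> \<open>Positivity of \<open>s + h i\<close> makes both expectations finite, so
        their difference can be taken under one integral.\<close>
      with i0[of i] s have "0 < s + h i" by auto
      then have "F m (s + h i) - F m s
          = expectation (\<lambda>\<omega>. X \<omega> ^ m * exp (- (s + h i) * X \<omega>) - X \<omega> ^ m * exp (- s * X \<omega>))"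
        unfolding F_def using nn s by (intro Bochner_Integration.integral_diff[symmetric] integrable_power_exp) auto
      then have "(F m (s + h i) - F m s) / h i
          = expectation (\<lambda>\<omega>. (X \<omega> ^ m * exp (- (s + h i) * X \<omega>) - X \<omega> ^ m * exp (- s * X \<omega>)) / h i)"
        by simp
      then show "expectation (?D i) = (F m (s + h i) - F m s) / h i"
        by (simp only: right_diff_distrib times_divide_eq_right)
    qed
    ultimately show "(\<lambda>i. (F m (s + h i) - F m s) / h i) \<longlonglongrightarrow> - F (Suc m) s"
      by (rule Lim_transform_eventually)
  qed
  then show ?thesis
    by (simp only: DERIV_def F_def)
qed

lemma higher_deriv_laplace_transform:
  fixes X :: "'a \<Rightarrow> real"
  assumes X: "X \<in> borel_measurable M" "AE \<omega> in M. 0 \<le> X \<omega>" and "0 < s"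
  shows "(deriv ^^ m) (\<lambda>s. expectation (\<lambda>\<omega>. exp (- s * X \<omega>))) s
    = (- 1) ^ m * expectation (\<lambda>\<omega>. X \<omega> ^ m * exp (- s * X \<omega>))"
  using \<open>0 < s\<close>
proof (induction m arbitrary: s)
  case (Suc m)
  let ?\<alpha> = "\<lambda>s. expectation (\<lambda>\<omega>. exp (- s * X \<omega>))"
  \<comment> \<open>The closed form is known only at positive arguments. They form an open set
    around \<open>s\<close>, which is enough for the derivative at \<open>s\<close>.\<close>
  have "eventually (\<lambda>t. (deriv ^^ m) ?\<alpha> t
      = (- 1) ^ m * expectation (\<lambda>\<omega>. X \<omega> ^ m * exp (- t * X \<omega>))) (nhds s)"
    by (rule eventually_mono[OF eventually_nhds_in_open[of "{0<..}" s]])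
      (use Suc.prems Suc.IH in simp_all)
  then have "deriv ((deriv ^^ m) ?\<alpha>) s
      = deriv (\<lambda>t. (- 1) ^ m * expectation (\<lambda>\<omega>. X \<omega> ^ m * exp (- t * X \<omega>))) s"
    by (rule deriv_cong_ev) simp
  also have "\<dots> = (- 1) ^ m * - expectation (\<lambda>\<omega>. X \<omega> ^ Suc m * exp (- s * X \<omega>))"
    by (intro DERIV_imp_deriv DERIV_cmult deriv_power_exp_expectation X Suc.prems)
  finally show ?case by simp
qed simp

end

section \<open>Poisson weights and Erlang densities\<close>

text \<open>For nonnegative \<open>\<mu>\<close> and \<open>y\<close> this is the probability that
  exactly \<open>m\<close> phases of rate \<open>\<mu>\<close> are completed during time
  \<open>y\<close>.\<close>

definition poisson_weight :: "real \<Rightarrow> nat \<Rightarrow> real \<Rightarrow> real" where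
  "poisson_weight \<mu> m y = exp (- \<mu> * y) * (\<mu> * y) ^ m / fact m"

lemma borel_measurable_poisson_weight [measurable]: "poisson_weight \<mu> m \<in> borel_measurable borel"
  unfolding poisson_weight_def[abs_def] by measurable

lemma poisson_weight_nonneg: "0 \<le> \<mu> \<Longrightarrow> 0 \<le> y \<Longrightarrow> 0 \<le> poisson_weight \<mu> m y"
  by (simp add: poisson_weight_def)

text \<open>The binomial theorem; in probabilistic terms, \<open>l\<close> of the \<open>m\<close>
  points fall into the stretch \<open>x\<close> and the others into \<open>y\<close>.\<close>

lemma poisson_weight_add:
  "poisson_weight \<mu> m (x + y) = (\<Sum>l\<le>m. poisson_weight \<mu> l x * poisson_weight \<mu> (m - l) y)"
proof -
  have "(\<mu> * x + \<mu> * y) ^ m / fact m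
      = (\<Sum>l\<le>m. (\<mu> * x) ^ l / fact l * ((\<mu> * y) ^ (m - l) / fact (m - l)))"
    unfolding binomial_ring sum_divide_distrib
    by (intro sum.cong refl) (simp add: binomial_fact)
  then have "exp (- \<mu> * x) * exp (- \<mu> * y) * ((\<mu> * x + \<mu> * y) ^ m / fact m)
      = (\<Sum>l\<le>m. poisson_weight \<mu> l x * poisson_weight \<mu> (m - l) y)"
    by (simp add: poisson_weight_def sum_distrib_left mult_ac)
  then show ?thesis
    by (simp add: poisson_weight_def distrib_left exp_diff exp_minus field_simps)
qed

lemma erlang_density_eq_poisson_weight:
  "0 \<le> x \<Longrightarrow> erlang_density k \<mu> x = \<mu> * poisson_weight \<mu> k x"
  by (simp add: erlang_density_def poisson_weight_def power_mult_distrib)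

text \<open>Memorylessness of the phases: during \<open>y\<close>, \<open>k - j\<close> of the
  \<open>k + 1\<close> phases are completed, which leaves \<open>j + 1\<close>.\<close>

lemma erlang_density_add:
  assumes "0 \<le> x" "0 \<le> y"
  shows "erlang_density k \<mu> (x + y) = (\<Sum>j\<le>k. poisson_weight \<mu> (k - j) y * erlang_density j \<mu> x)"
  using assms
  by (simp add: erlang_density_eq_poisson_weight poisson_weight_add sum_distrib_left mult_ac)

lemma nn_integral_erlang_density_eq_1:
  assumes "0 < \<mu>"
  shows "(\<integral>\<^sup>+x. ennreal (erlang_density k \<mu> x) \<partial>lborel) = 1"
  using prob_space.emeasure_space_1[OF prob_space_erlang_density[OF assms, of k]]
  by (simp add: emeasure_density)

text \<open>The integrand is a constant times an Erlang density with \<open>i + l + 1\<close> phases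
  and rate \<open>2 * \<mu>\<close>. The constant is the negative binomial probability of
  \<open>l\<close> failures before success number \<open>i + 1\<close> of a fair coin.\<close>

lemma nn_integral_poisson_weight_erlang:
  assumes "0 < \<mu>"
  shows "(\<integral>\<^sup>+x. ennreal (poisson_weight \<mu> l x) * ennreal (erlang_density i \<mu> x) \<partial>lborel)
    = ennreal (real ((i + l) choose i) / 2 ^ (i + l + 1))"
proof -
  have "ennreal (poisson_weight \<mu> l x) * ennreal (erlang_density i \<mu> x)
      = ennreal (real ((i + l) choose i) / 2 ^ (i + l + 1)) * ennreal (erlang_density (i + l) (2 * \<mu>) x)" for x
  proof (cases "0 \<le> x")
    case True
    have "exp (- (\<mu> * x)) * exp (- (\<mu> * x)) = exp (- (2 * \<mu> * x))"
      by (simp flip: exp_add)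
    moreover have "real ((i + l) choose i) = fact (i + l) / (fact i * fact l)"
      by (simp add: binomial_fact)
    ultimately have "poisson_weight \<mu> l x * erlang_density i \<mu> x
        = real ((i + l) choose i) / 2 ^ (i + l + 1) * erlang_density (i + l) (2 * \<mu>) x"
      using True by (simp add: poisson_weight_def erlang_density_def power_mult_distrib power_add mult_ac)
    with True assms show ?thesis
      by (simp add: poisson_weight_nonneg flip: ennreal_mult)
  qed (simp add: erlang_density_def)
  with assms show ?thesis
    by (simp add: nn_integral_cmult nn_integral_erlang_density_eq_1)
qed

text \<open>Substituting \<open>b = x + y\<close> makes the excess over \<open>y\<close> the
  integration variable; \<open>erlang_density_add\<close> then splits the density.\<close>

lemma nn_integral_residual_erlang:
  fixes h :: "real \<Rightarrow> ennreal"
  assumes [measurable]: "h \<in> borel_measurable borel" and "0 \<le> y" "0 < \<mu>"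
  shows "(\<integral>\<^sup>+b. (if 0 < b - y then h (b - y) else 0) * ennreal (erlang_density k \<mu> b) \<partial>lborel)
    = (\<Sum>j\<le>k. ennreal (poisson_weight \<mu> (k - j) y) * (\<integral>\<^sup>+x. h x * ennreal (erlang_density j \<mu> x) \<partial>lborel))"
proof -
  have "(\<integral>\<^sup>+b. (if 0 < b - y then h (b - y) else 0) * ennreal (erlang_density k \<mu> b) \<partial>lborel)
      = (\<integral>\<^sup>+x. (if 0 < x then h x else 0) * ennreal (erlang_density k \<mu> (x + y)) \<partial>lborel)"
    by (subst nn_integral_real_affine[where c = 1 and t = y]) (auto simp: add.commute intro!: nn_integral_cong)
  also have "\<dots> = (\<integral>\<^sup>+x. (\<Sum>j\<le>k. ennreal (poisson_weight \<mu> (k - j) y) * (h x * ennreal (erlang_density j \<mu> x))) \<partial>lborel)"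
  proof (rule nn_integral_cong_AE)
    show "AE x in lborel. (if 0 < x then h x else 0) * ennreal (erlang_density k \<mu> (x + y))
        = (\<Sum>j\<le>k. ennreal (poisson_weight \<mu> (k - j) y) * (h x * ennreal (erlang_density j \<mu> x)))"
      \<comment> \<open>The point 0 must be excluded: the left side vanishes there, but the density
        for \<open>j = 0\<close> does not.\<close>
      using AE_lborel_singleton[of 0]
    proof eventually_elim
      case (elim x)
      show ?case
      proof (cases "0 < x")
        case True
        with assms show ?thesis
          by (simp add: erlang_density_add poisson_weight_nonneg ennreal_mult sum_distrib_left mult_ac
              flip: sum_ennreal)
      next
        case False
        with elim show ?thesis by (simp add: erlang_density_def)
      qed
    qed
  qed
  also have "\<dots> = (\<Sum>j\<le>k. ennreal (poisson_weight \<mu> (k - j) y) * (\<integral>\<^sup>+x. h x * ennreal (erlang_density j \<mu> x) \<partial>lborel))"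
    by (simp add: nn_integral_sum nn_integral_cmult)
  finally show ?thesis .
qed

section \<open>Integrals over independent variables\<close>

context prob_space
begin

text \<open>The joint law is a product measure, so Tonelli allows \<open>Y\<close> to be integrated
  out first.\<close>

lemma nn_integral_indep_var:
  assumes "indep_var S X T Y" and [measurable]: "f \<in> borel_measurable (S \<Otimes>\<^sub>M T)"
  shows "(\<integral>\<^sup>+\<omega>. f (X \<omega>, Y \<omega>) \<partial>M) = (\<integral>\<^sup>+\<omega>. (\<integral>\<^sup>+y. f (X \<omega>, y) \<partial>distr M T Y) \<partial>M)"
proof -
  have [measurable]: "X \<in> measurable M S" "Y \<in> measurable M T"
    and eq: "distr M S X \<Otimes>\<^sub>M distr M T Y = distr M (S \<Otimes>\<^sub>M T) (\<lambda>\<omega>. (X \<omega>, Y \<omega>))"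
    using assms(1) by (auto simp: indep_var_distribution_eq)
  interpret Y: prob_space "distr M T Y" by (rule prob_space_distr) measurable
  have "(\<integral>\<^sup>+\<omega>. f (X \<omega>, Y \<omega>) \<partial>M) = (\<integral>\<^sup>+z. f z \<partial>(distr M S X \<Otimes>\<^sub>M distr M T Y))"
    by (simp add: eq nn_integral_distr)
  also have "\<dots> = (\<integral>\<^sup>+x. (\<integral>\<^sup>+y. f (x, y) \<partial>distr M T Y) \<partial>distr M S X)"
    by (subst Y.nn_integral_fst[symmetric]) simp_all
  also have "\<dots> = (\<integral>\<^sup>+\<omega>. (\<integral>\<^sup>+y. f (X \<omega>, y) \<partial>distr M T Y) \<partial>M)"
    by (subst nn_integral_distr) simp_all
  finally show ?thesis .
qed

lemma nn_integral_indep_var_mult: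
  assumes "indep_var S X T Y" and [measurable]: "f \<in> borel_measurable S" "g \<in> borel_measurable T"
  shows "(\<integral>\<^sup>+\<omega>. f (X \<omega>) * g (Y \<omega>) \<partial>M) = (\<integral>\<^sup>+\<omega>. f (X \<omega>) \<partial>M) * (\<integral>\<^sup>+\<omega>. g (Y \<omega>) \<partial>M)"
proof -
  have [measurable]: "X \<in> measurable M S" "Y \<in> measurable M T"
    using assms(1) by (auto simp: indep_var_distribution_eq)
  show ?thesis
    using nn_integral_indep_var[OF assms(1), of "\<lambda>(x, y). f x * g y"]
    by (simp add: nn_integral_cmult nn_integral_multc nn_integral_distr)
qed

text \<open>\<open>B\<close> is integrated out for a fixed value of \<open>V\<close>. The test
  \<open>0 \<le> V \<omega>\<close> lets negative values of \<open>V\<close> mark outcomes on which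
  the process has already been killed.\<close>

lemma nn_integral_residual_service:
  fixes V B :: "'a \<Rightarrow> real" and h :: "real \<Rightarrow> ennreal"
  assumes indep: "indep_var borel V borel B"
    and B: "distributed M lborel B (erlang_density k \<mu>)" and "0 < \<mu>"
    and [measurable]: "h \<in> borel_measurable borel"
  shows "(\<integral>\<^sup>+\<omega>. (if 0 \<le> V \<omega> \<and> 0 < B \<omega> - V \<omega> then h (B \<omega> - V \<omega>) else 0) \<partial>M)
    = (\<Sum>j\<le>k. (\<integral>\<^sup>+\<omega>. indicator {0..} (V \<omega>) * ennreal (poisson_weight \<mu> (k - j) (V \<omega>)) \<partial>M)
        * (\<integral>\<^sup>+x. h x * ennreal (erlang_density j \<mu> x) \<partial>lborel))"
proof -
  have [measurable]: "V \<in> borel_measurable M"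
    using indep by (auto simp: indep_var_distribution_eq)
  have distr_B: "distr M borel B = density lborel (erlang_density k \<mu>)"
    using distributed_distr_eq_density[OF B] by (simp cong: distr_cong)
  let ?g = "\<lambda>j. \<integral>\<^sup>+x. h x * ennreal (erlang_density j \<mu> x) \<partial>lborel"
  let ?f = "\<lambda>(v, b). if 0 \<le> v \<and> 0 < b - v then h (b - v) else 0"
  have "(\<integral>\<^sup>+\<omega>. ?f (V \<omega>, B \<omega>) \<partial>M)
      = (\<integral>\<^sup>+\<omega>. (\<integral>\<^sup>+b. ?f (V \<omega>, b) \<partial>distr M borel B) \<partial>M)"
    by (rule nn_integral_indep_var[OF indep]) measurable
  also have "\<dots> = (\<integral>\<^sup>+\<omega>. (\<Sum>j\<le>k. indicator {0..} (V \<omega>) * ennreal (poisson_weight \<mu> (k - j) (V \<omega>)) * ?g j) \<partial>M)"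
  proof (rule nn_integral_cong)
    fix \<omega>
    show "(\<integral>\<^sup>+b. ?f (V \<omega>, b) \<partial>distr M borel B)
        = (\<Sum>j\<le>k. indicator {0..} (V \<omega>) * ennreal (poisson_weight \<mu> (k - j) (V \<omega>)) * ?g j)"
    proof (cases "0 \<le> V \<omega>")
      case True
      with nn_integral_residual_erlang[of h "V \<omega>" \<mu> k] \<open>0 < \<mu>\<close> show ?thesis
        unfolding distr_B by (subst nn_integral_density) (simp_all add: mult.commute)
    qed simp
  qed
  also have "\<dots> = (\<Sum>j\<le>k. (\<integral>\<^sup>+\<omega>. indicator {0..} (V \<omega>) * ennreal (poisson_weight \<mu> (k - j) (V \<omega>)) \<partial>M) * ?g j)"
    by (simp add: nn_integral_sum nn_integral_multc)
  finally show ?thesis by simp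
qed

text \<open>The convolution identity is applied pointwise and independence factors each term. The
  indicator keeps the weights of \<open>K\<close> nonnegative, so that \<open>ennreal\<close>
  respects the products.\<close>

lemma nn_integral_poisson_weight_add:
  fixes K A :: "'a \<Rightarrow> real"
  assumes indep: "indep_var borel K borel A" and A: "AE \<omega> in M. 0 \<le> A \<omega>" and "0 < \<mu>"
  shows "(\<integral>\<^sup>+\<omega>. indicator {0..} (K \<omega>) * ennreal (poisson_weight \<mu> m (A \<omega> + K \<omega>)) \<partial>M)
    = (\<Sum>l\<le>m. (\<integral>\<^sup>+\<omega>. indicator {0..} (K \<omega>) * ennreal (poisson_weight \<mu> l (K \<omega>)) \<partial>M)
        * (\<integral>\<^sup>+\<omega>. ennreal (poisson_weight \<mu> (m - l) (A \<omega>)) \<partial>M))"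
proof -
  have [measurable]: "K \<in> borel_measurable M" "A \<in> borel_measurable M"
    using indep by (auto simp: indep_var_distribution_eq)
  have "(\<integral>\<^sup>+\<omega>. indicator {0..} (K \<omega>) * ennreal (poisson_weight \<mu> m (A \<omega> + K \<omega>)) \<partial>M)
      = (\<integral>\<^sup>+\<omega>. (\<Sum>l\<le>m. (indicator {0..} (K \<omega>) * ennreal (poisson_weight \<mu> l (K \<omega>)))
          * ennreal (poisson_weight \<mu> (m - l) (A \<omega>))) \<partial>M)"
  proof (rule nn_integral_cong_AE)
    show "AE \<omega> in M. indicator {0..} (K \<omega>) * ennreal (poisson_weight \<mu> m (A \<omega> + K \<omega>))
        = (\<Sum>l\<le>m. (indicator {0..} (K \<omega>) * ennreal (poisson_weight \<mu> l (K \<omega>)))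
          * ennreal (poisson_weight \<mu> (m - l) (A \<omega>)))"
      using A
    proof eventually_elim
      case (elim \<omega>)
      show ?case
      proof (cases "0 \<le> K \<omega>")
        case True
        with elim \<open>0 < \<mu>\<close> show ?thesis
          by (simp add: add.commute[of "A \<omega>"] poisson_weight_add poisson_weight_nonneg ennreal_mult flip: sum_ennreal)
      qed simp
    qed
  qed
  also have "\<dots> = (\<Sum>l\<le>m. (\<integral>\<^sup>+\<omega>. indicator {0..} (K \<omega>) * ennreal (poisson_weight \<mu> l (K \<omega>)) \<partial>M)
        * (\<integral>\<^sup>+\<omega>. ennreal (poisson_weight \<mu> (m - l) (A \<omega>)) \<partial>M))"
    by (subst nn_integral_sum, measurable, intro sum.cong refl nn_integral_indep_var_mult[OF indep]) measurable
  finally show ?thesis .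
qed

section \<open>Transition probabilities as expectations\<close>

text \<open>The sign \<open>(- 1) ^ m\<close> of the derivative cancels against the sign in
  \<open>(- \<mu>) ^ m\<close>.\<close>

lemma expectation_poisson_weight:
  fixes X :: "'a \<Rightarrow> real"
  assumes "X \<in> borel_measurable M" "AE \<omega> in M. 0 \<le> X \<omega>" "0 < \<mu>"
  shows "expectation (\<lambda>\<omega>. poisson_weight \<mu> m (X \<omega>))
    = (- \<mu>) ^ m / fact m * (deriv ^^ m) (\<lambda>s. expectation (\<lambda>\<omega>. exp (- s * X \<omega>))) \<mu>"
proof -
  have "expectation (\<lambda>\<omega>. poisson_weight \<mu> m (X \<omega>))
      = expectation (\<lambda>\<omega>. \<mu> ^ m / fact m * (X \<omega> ^ m * exp (- \<mu> * X \<omega>)))"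
    by (simp add: poisson_weight_def power_mult_distrib mult_ac)
  also have "\<dots> = \<mu> ^ m / fact m * expectation (\<lambda>\<omega>. X \<omega> ^ m * exp (- \<mu> * X \<omega>))"
    by simp
  finally show ?thesis
    unfolding higher_deriv_laplace_transform[OF assms] by (simp flip: power_mult_distrib)
qed

lemma integrable_poisson_weight:
  fixes X :: "'a \<Rightarrow> real"
  assumes "X \<in> borel_measurable M" "AE \<omega> in M. 0 \<le> X \<omega>" "0 < \<mu>"
  shows "integrable M (\<lambda>\<omega>. poisson_weight \<mu> m (X \<omega>))"
proof -
  have "integrable M (\<lambda>\<omega>. \<mu> ^ m / fact m * (X \<omega> ^ m * exp (- \<mu> * X \<omega>)))"
    by (intro integrable_mult_right integrable_power_exp assms)
  then show ?thesis
    by (simp add: poisson_weight_def power_mult_distrib mult_ac)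
qed

text \<open>The state space is {0, ..., k + 1} and the truncated differences k - j, with j <= k, count the
  phases completed out of k + 1 when j + 1 remain.\<close>
lemma trans_p_0_eq:
  fixes X :: "'a \<Rightarrow> real"
  assumes "X \<in> borel_measurable M" "AE \<omega> in M. 0 \<le> X \<omega>" "0 < \<mu>"
  shows "trans_p (\<lambda>s. expectation (\<lambda>\<omega>. exp (- s * X \<omega>))) \<mu> (Suc k) 0 (Suc j)
    = expectation (\<lambda>\<omega>. poisson_weight \<mu> (k - j) (X \<omega>))"
  unfolding expectation_poisson_weight[OF assms] by (simp add: trans_p_def)

text \<open>Out of the \<open>k - j\<close> completed phases, \<open>l\<close> are completed during
  a waiting time with \<open>i + 1\<close> phases and the remaining ones during
  \<open>X\<close>.\<close>

lemma trans_p_Suc_eq: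
  fixes X :: "'a \<Rightarrow> real"
  assumes "X \<in> borel_measurable M" "AE \<omega> in M. 0 \<le> X \<omega>" "0 < \<mu>"
  shows "trans_p (\<lambda>s. expectation (\<lambda>\<omega>. exp (- s * X \<omega>))) \<mu> (Suc k) (Suc i) (Suc j)
    = (\<Sum>l\<le>k - j. real ((i + l) choose i) / 2 ^ (i + l + 1) * expectation (\<lambda>\<omega>. poisson_weight \<mu> (k - j - l) (X \<omega>)))"
proof -
  let ?d = "\<lambda>m. (deriv ^^ m) (\<lambda>s. expectation (\<lambda>\<omega>. exp (- s * X \<omega>))) \<mu>"
  \<comment> \<open>Here \<open>c\<close> is the binomial coefficient, \<open>d\<close> the
    derivative and \<open>f\<close> its factorial. A factor \<open>(- \<mu>) ^ l\<close> split off
    the leading power cancels against \<open>(- 1 / (2 * \<mu>)) ^ l\<close> and leaves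
    \<open>1 / 2 ^ l\<close>.\<close>
  have rescale: "(- \<mu>) ^ m / 2 ^ Suc i * (c * (d / f) * (- 1 / (2 * \<mu>)) ^ l)
      = c / 2 ^ (i + l + 1) * ((- \<mu>) ^ (m - l) / f * d)" if "l \<le> m" for m l and c d f :: real
  proof -
    have "(- \<mu>) ^ m = (- \<mu>) ^ (m - l) * (- \<mu>) ^ l"
      using that by (simp flip: power_add)
    moreover have "(- 1 / (2 * \<mu>)) ^ l = 1 / (2 ^ l * (- \<mu>) ^ l)"
    proof -
      have "- 1 / (2 * \<mu>) = 1 / (2 * (- \<mu>))" by simp
      then show ?thesis by (simp only: power_divide power_mult_distrib power_one)
    qed
    moreover have "x * z / 2 ^ Suc i * (c * (d / f) * (1 / (2 ^ l * z)))
        = c / 2 ^ (i + l + 1) * (x / f * d)" if "z \<noteq> 0" for x z :: real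
      using that by (simp add: power_add mult_ac)
    moreover have "(- \<mu>) ^ l \<noteq> 0"
      using \<open>0 < \<mu>\<close> by simp
    ultimately show ?thesis
      by (simp only: not_False_eq_True)
  qed
  show ?thesis
    unfolding expectation_poisson_weight[OF assms] trans_p_def
    by (simp only: nat.distinct if_False diff_Suc_Suc diff_Suc_1 add_Suc sum_distrib_left atMost_atLeast0)
      (intro sum.cong refl rescale, simp)
qed

end

section \<open>The waiting time process killed at its first return to 0\<close>

text \<open>The value is W (n+1) as long as W 2, ..., W (n+1) are all positive; afterwards the process is
  sent to the cemetery state -1.\<close>
primrec killed_waiting :: "(nat \<Rightarrow> 'a \<Rightarrow> real) \<Rightarrow> (nat \<Rightarrow> 'a \<Rightarrow> real) \<Rightarrow> nat \<Rightarrow> 'a \<Rightarrow> real" where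
  "killed_waiting A B 0 \<omega> = 0"
| "killed_waiting A B (Suc n) \<omega> =
     (let x = B (Suc (Suc n)) \<omega> - A (Suc n) \<omega> - killed_waiting A B n \<omega>
      in if 0 \<le> killed_waiting A B n \<omega> \<and> 0 < x then x else - 1)"

text \<open>A nonnegative value at step \<open>n + 1\<close> forces a nonnegative one at step
  \<open>n\<close> and a positive difference, so the maximum with 0 has no effect.\<close>

lemma killed_waiting_alive:
  "0 \<le> killed_waiting A B n \<omega> \<Longrightarrow> killed_waiting A B n \<omega> = waiting A B (Suc n) \<omega>"
  by (induction n) (auto simp: Let_def split: if_splits)

text \<open>The cemetery is absorbing, and the strict test \<open>0 < x\<close> counts a return to 0
  as death. The initial zero \<open>W 1\<close> is exempt, so \<open>k\<close> starts at 1.\<close>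

lemma killed_waiting_nonneg_iff:
  "0 \<le> killed_waiting A B n \<omega> \<longleftrightarrow> (\<forall>k\<in>{1..n}. waiting A B (Suc k) \<omega> \<noteq> 0)"
proof (induction n)
  case (Suc n)
  have "0 \<le> killed_waiting A B (Suc n) \<omega> \<longleftrightarrow>
      0 \<le> killed_waiting A B n \<omega> \<and> waiting A B (Suc (Suc n)) \<omega> \<noteq> 0"
    using killed_waiting_alive[of A B n \<omega>] by (auto simp: Let_def max_def)
  with Suc.IH show ?case
    by (auto simp: atLeastAtMostSuc_conv)
qed simp

text \<open>A finite infimum comes from a nonempty set and is attained, by well-ordering.\<close>

lemma Inf_enat_eq_iff:
  fixes S :: "enat set"
  shows "Inf S = enat m \<longleftrightarrow> enat m \<in> S \<and> (\<forall>x\<in>S. enat m \<le> x)"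
proof
  assume *: "Inf S = enat m"
  then have "S \<noteq> {}" by (auto simp: Inf_enat_def)
  then have "Inf S \<in> S" by (auto simp: Inf_enat_def intro: LeastI)
  with * show "enat m \<in> S \<and> (\<forall>x\<in>S. enat m \<le> x)"
    using Inf_lower[of _ S] by auto
next
  assume "enat m \<in> S \<and> (\<forall>x\<in>S. enat m \<le> x)"
  then show "Inf S = enat m"
    by (intro antisym Inf_lower Inf_greatest) auto
qed

lemma cycle_len_eq_enat_Suc_iff:
  "cycle_len A B \<omega> = enat (Suc n) \<longleftrightarrow>
    0 \<le> killed_waiting A B n \<omega> \<and> \<not> 0 \<le> killed_waiting A B (Suc n) \<omega>"
proof -
  let ?S = "{enat k | k. k \<ge> 1 \<and> waiting A B (1 + k) \<omega> = 0}"
  have "Inf ?S = enat m \<longleftrightarrow> enat m \<in> ?S \<and> (\<forall>x\<in>?S. enat m \<le> x)" for m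
    by (rule Inf_enat_eq_iff)
  then have "cycle_len A B \<omega> = enat (Suc n) \<longleftrightarrow> waiting A B (Suc (Suc n)) \<omega> = 0 \<and>
      (\<forall>k\<ge>1. waiting A B (Suc k) \<omega> = 0 \<longrightarrow> Suc n \<le> k)"
    unfolding cycle_len_def by (auto simp del: waiting.simps)
  also have "\<dots> \<longleftrightarrow> (\<forall>k\<in>{1..n}. waiting A B (Suc k) \<omega> \<noteq> 0) \<and> waiting A B (Suc (Suc n)) \<omega> = 0"
    by (auto simp: not_less_eq_eq[symmetric] simp del: waiting.simps)
  also have "\<dots> \<longleftrightarrow> 0 \<le> killed_waiting A B n \<omega> \<and> \<not> 0 \<le> killed_waiting A B (Suc n) \<omega>"
    unfolding killed_waiting_nonneg_iff by (auto simp: atLeastAtMostSuc_conv simp del: waiting.simps)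
  finally show ?thesis .
qed

text \<open>Restricting the hypotheses to finitely many indices makes this applicable to the
  coordinate maps of a finite product space.\<close>

lemma measurable_killed_waiting:
  assumes "\<And>k. 1 \<le> k \<Longrightarrow> k \<le> n \<Longrightarrow> A k \<in> borel_measurable M"
    and "\<And>k. 1 \<le> k \<Longrightarrow> k \<le> Suc n \<Longrightarrow> B k \<in> borel_measurable M"
  shows "killed_waiting A B n \<in> borel_measurable M"
  using assms
proof (induction n)
  case 0
  have "killed_waiting A B 0 = (\<lambda>_. 0)" by auto
  then show ?case by simp
next
  case (Suc n)
  then have [measurable]: "killed_waiting A B n \<in> borel_measurable M"
    "A (Suc n) \<in> borel_measurable M" "B (Suc (Suc n)) \<in> borel_measurable M"
    by auto
  have "killed_waiting A B (Suc n) = (\<lambda>\<omega>.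
      if 0 \<le> killed_waiting A B n \<omega> \<and> 0 < B (Suc (Suc n)) \<omega> - A (Suc n) \<omega> - killed_waiting A B n \<omega>
      then B (Suc (Suc n)) \<omega> - A (Suc n) \<omega> - killed_waiting A B n \<omega> else - 1)"
    by (auto simp: Let_def)
  then show ?case by simp
qed

text \<open>The two sample points may live in different spaces; this identifies the process with the
  same recursion run on coordinates.\<close>

lemma killed_waiting_cong:
  assumes "\<And>k. 1 \<le> k \<Longrightarrow> k \<le> n \<Longrightarrow> A k \<omega> = A' k \<omega>'"
    and "\<And>k. 1 \<le> k \<Longrightarrow> k \<le> Suc n \<Longrightarrow> B k \<omega> = B' k \<omega>'"
  shows "killed_waiting A B n \<omega> = killed_waiting A' B' n \<omega>'"
  using assms
proof (induction n)
  case (Suc n)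
  then have "killed_waiting A B n \<omega> = killed_waiting A' B' n \<omega>'"
    "A (Suc n) \<omega> = A' (Suc n) \<omega>'" "B (Suc (Suc n)) \<omega> = B' (Suc (Suc n)) \<omega>'"
    by auto
  then show ?case by (simp add: Let_def)
qed simp

lemma sum_ennreal_mult_sum:
  assumes "\<And>i. 0 \<le> a i" "\<And>i l. 0 \<le> c i l" "\<And>l. 0 \<le> e l"
  shows "(\<Sum>l\<in>L. (\<Sum>i\<in>I. ennreal (a i) * ennreal (c i l)) * ennreal (e l))
    = ennreal (\<Sum>l\<in>L. (\<Sum>i\<in>I. a i * c i l) * e l)"
  using assms by (simp add: ennreal_mult sum_nonneg flip: sum_ennreal)

text \<open>Step n and index j stand for the event that W 2, ..., W (n+2) are positive and that j + 1 phases
  remain when W (n+2) starts.\<close>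
primrec phase_mass :: "(nat \<Rightarrow> nat \<Rightarrow> real) \<Rightarrow> nat \<Rightarrow> nat \<Rightarrow> nat \<Rightarrow> real" where
  "phase_mass p k 0 j = p 0 (Suc j)"
| "phase_mass p k (Suc n) j = (\<Sum>i\<le>k. phase_mass p k n i * p (Suc i) (Suc j))"

section \<open>Evolution of the phase masses in the model\<close>

text \<open>The parameter \<open>k\<close> follows \<open>erlang_density\<close>: there are
  \<open>k + 1\<close> phases, so \<open>N\<close> is \<open>Suc k\<close>.\<close>

locale alternating_service = prob_space M for M :: "'a measure" +
  fixes A B :: "nat \<Rightarrow> 'a \<Rightarrow> real" and k :: nat and \<mu> :: real
  assumes rate_pos: "0 < \<mu>"
    and A_meas: "\<And>n. 1 \<le> n \<Longrightarrow> A n \<in> borel_measurable M"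
    and A_nonneg: "\<And>n. 1 \<le> n \<Longrightarrow> AE \<omega> in M. 0 \<le> A n \<omega>"
    and A_distr: "\<And>n. 1 \<le> n \<Longrightarrow> distr M borel (A n) = distr M borel (A 1)"
    and B_erlang: "\<And>n. 1 \<le> n \<Longrightarrow> distributed M lborel (B n) (erlang_density k \<mu>)"
    and indep: "indep_vars (\<lambda>_. borel) (\<lambda>i. case i of Inl n \<Rightarrow> A n | Inr n \<Rightarrow> B n)
      ({Inl n | n. 1 \<le> n} \<union> {Inr n | n. 1 \<le> n})"
begin

lemma B_meas: "1 \<le> n \<Longrightarrow> B n \<in> borel_measurable M"
  using distributed_measurable[OF B_erlang] by simp

definition laplace :: "real \<Rightarrow> real" where
  "laplace s = expectation (\<lambda>\<omega>. exp (- s * A 1 \<omega>))"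

abbreviation p :: "nat \<Rightarrow> nat \<Rightarrow> real" where
  "p \<equiv> trans_p laplace \<mu> (Suc k)"

lemma p_0_eq: "p 0 (Suc j) = expectation (\<lambda>\<omega>. poisson_weight \<mu> (k - j) (A 1 \<omega>))"
  unfolding laplace_def[abs_def]
  using trans_p_0_eq[of "A 1" \<mu> k j] A_meas A_nonneg rate_pos by simp

lemma p_Suc_eq: "p (Suc i) (Suc j) = (\<Sum>l\<le>k - j. real ((i + l) choose i) / 2 ^ (i + l + 1)
    * expectation (\<lambda>\<omega>. poisson_weight \<mu> (k - j - l) (A 1 \<omega>)))"
  unfolding laplace_def[abs_def]
  using trans_p_Suc_eq[of "A 1" \<mu> k i j] A_meas A_nonneg rate_pos by simp

lemma expectation_poisson_weight_nonneg:
  "0 \<le> expectation (\<lambda>\<omega>. poisson_weight \<mu> m (A 1 \<omega>))"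
proof (rule integral_nonneg_AE)
  show "AE \<omega> in M. 0 \<le> poisson_weight \<mu> m (A 1 \<omega>)"
    by (rule eventually_mono[OF A_nonneg[of 1]]) (use rate_pos in \<open>simp_all add: poisson_weight_nonneg\<close>)
qed

lemma p_nonneg: "0 \<le> p 0 (Suc j)" "0 \<le> p (Suc i) (Suc j)"
  unfolding p_0_eq p_Suc_eq
  by (intro expectation_poisson_weight_nonneg sum_nonneg mult_nonneg_nonneg divide_nonneg_pos; simp)+

lemma phase_mass_nonneg: "0 \<le> phase_mass p k n j"
  by (induction n arbitrary: j) (auto intro!: p_nonneg sum_nonneg mult_nonneg_nonneg)

lemma nn_integral_poisson_weight:
  assumes "1 \<le> n"
  shows "(\<integral>\<^sup>+\<omega>. ennreal (poisson_weight \<mu> m (A n \<omega>)) \<partial>M)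
    = ennreal (expectation (\<lambda>\<omega>. poisson_weight \<mu> m (A 1 \<omega>)))"
proof -
  have "(\<integral>\<^sup>+\<omega>. ennreal (poisson_weight \<mu> m (A n \<omega>)) \<partial>M)
      = (\<integral>\<^sup>+x. ennreal (poisson_weight \<mu> m x) \<partial>distr M borel (A n))"
    using A_meas[OF assms] by (subst nn_integral_distr) simp_all
  also have "\<dots> = (\<integral>\<^sup>+x. ennreal (poisson_weight \<mu> m x) \<partial>distr M borel (A 1))"
    by (simp only: A_distr[OF assms])
  also have "\<dots> = (\<integral>\<^sup>+\<omega>. ennreal (poisson_weight \<mu> m (A 1 \<omega>)) \<partial>M)"
    using A_meas[of 1] by (subst nn_integral_distr) simp_all
  also have "\<dots> = ennreal (expectation (\<lambda>\<omega>. poisson_weight \<mu> m (A 1 \<omega>)))"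
  proof (rule nn_integral_eq_integral)
    show "AE \<omega> in M. 0 \<le> poisson_weight \<mu> m (A 1 \<omega>)"
      by (rule eventually_mono[OF A_nonneg[of 1]]) (use rate_pos in \<open>simp_all add: poisson_weight_nonneg\<close>)
  qed (use A_meas A_nonneg rate_pos in \<open>auto intro: integrable_poisson_weight\<close>)
  finally show ?thesis .
qed

text \<open>Functions of disjoint groups of independent variables are independent; the groups are a
  finite past and one later input.\<close>

lemma indep_var_past_input:
  assumes "F \<in> borel_measurable (PiM (Inl ` {1..n} \<union> Inr ` {1..m}) (\<lambda>_. borel))"
    and "i \<in> Inl ` {Suc n..} \<union> Inr ` {Suc m..}"
  shows "indep_var borel (\<lambda>\<omega>. F (\<lambda>i\<in>Inl ` {1..n} \<union> Inr ` {1..m}. case i of Inl n \<Rightarrow> A n \<omega> | Inr n \<Rightarrow> B n \<omega>))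
    borel (\<lambda>\<omega>. case i of Inl n \<Rightarrow> A n \<omega> | Inr n \<Rightarrow> B n \<omega>)"
proof -
  let ?X = "\<lambda>i. case i of Inl n \<Rightarrow> A n | Inr n \<Rightarrow> B n"
  let ?J = "Inl ` {1..n} \<union> Inr ` {1..m}"
  have "indep_var (PiM ?J (\<lambda>_. borel)) (\<lambda>\<omega>. \<lambda>i\<in>?J. ?X i \<omega>) (PiM {i} (\<lambda>_. borel)) (\<lambda>\<omega>. \<lambda>i\<in>{i}. ?X i \<omega>)"
    by (rule indep_var_restrict[OF indep]) (use assms(2) in auto)
  from indep_var_compose[OF this assms(1), of "\<lambda>f. f i" borel]
  have "indep_var borel (\<lambda>\<omega>. F (\<lambda>i\<in>?J. ?X i \<omega>)) borel (\<lambda>\<omega>. ?X i \<omega>)"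
    by (simp add: o_def)
  moreover have "?X j \<omega> = (case j of Inl n \<Rightarrow> A n \<omega> | Inr n \<Rightarrow> B n \<omega>)" for j \<omega>
    by (simp split: sum.split)
  ultimately show ?thesis by simp
qed

text \<open>Step \<open>n\<close> is a function of \<open>A\<close> up to index \<open>n\<close> and
  \<open>B\<close> up to index \<open>n + 1\<close>, so \<open>A (Suc n)\<close> is a fresh
  input.\<close>

lemma indep_var_killed_waiting_A:
  "indep_var borel (killed_waiting A B n) borel (A (Suc n))"
proof -
  let ?J = "Inl ` {1..n} \<union> Inr ` {1..Suc n} :: (nat + nat) set"
  let ?F = "killed_waiting (\<lambda>k f. f (Inl k)) (\<lambda>k f. f (Inr k)) n"
  have "?F \<in> borel_measurable (PiM ?J (\<lambda>_. borel))"
    by (rule measurable_killed_waiting) (auto intro!: measurable_component_singleton)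
  moreover have "?F (\<lambda>i\<in>?J. case i of Inl n \<Rightarrow> A n \<omega> | Inr n \<Rightarrow> B n \<omega>) = killed_waiting A B n \<omega>" for \<omega>
    by (rule killed_waiting_cong) auto
  ultimately show ?thesis
    using indep_var_past_input[of ?F n "Suc n" "Inl (Suc n)"] by simp
qed

text \<open>This variable is the threshold that the next \<open>B\<close> must exceed; the value -1
  records that the process is already dead.\<close>

lemma indep_var_killed_waiting_B:
  "indep_var borel (\<lambda>\<omega>. if 0 \<le> killed_waiting A B n \<omega> then A (Suc n) \<omega> + killed_waiting A B n \<omega> else - 1)
    borel (B (Suc (Suc n)))"
proof -
  let ?J = "Inl ` {1..Suc n} \<union> Inr ` {1..Suc n} :: (nat + nat) set"
  let ?K = "killed_waiting (\<lambda>k f. f (Inl k)) (\<lambda>k f. f (Inr k)) n"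
  have [measurable]: "?K \<in> borel_measurable (PiM ?J (\<lambda>_. borel))"
    by (rule measurable_killed_waiting) (auto intro!: measurable_component_singleton)
  have [measurable]: "(\<lambda>f. f (Inl (Suc n))) \<in> borel_measurable (PiM ?J (\<lambda>_. borel))"
    by (auto intro!: measurable_component_singleton)
  have eq: "?K (\<lambda>i\<in>?J. case i of Inl n \<Rightarrow> A n \<omega> | Inr n \<Rightarrow> B n \<omega>) = killed_waiting A B n \<omega>" for \<omega>
    by (rule killed_waiting_cong) auto
  have eq': "(\<lambda>i\<in>?J. case i of Inl n \<Rightarrow> A n \<omega> | Inr n \<Rightarrow> B n \<omega>) (Inl (Suc n)) = A (Suc n) \<omega>" for \<omega>
    by simp
  have "(\<lambda>f. if 0 \<le> ?K f then f (Inl (Suc n)) + ?K f else - 1) \<in> borel_measurable (PiM ?J (\<lambda>_. borel))"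
    by measurable
  from indep_var_past_input[OF this, of "Inr (Suc (Suc n))"] show ?thesis
    unfolding eq eq' by simp
qed

text \<open>One step of the recursion, with the threshold as \<open>V\<close> in
  \<open>nn_integral_residual_service\<close>. As \<open>A (Suc n)\<close> is almost surely
  nonnegative, the threshold is nonnegative exactly on survival, up to a null set.\<close>

lemma nn_integral_killed_waiting_Suc:
  fixes h :: "real \<Rightarrow> ennreal"
  assumes [measurable]: "h \<in> borel_measurable borel"
  shows "(\<integral>\<^sup>+\<omega>. indicator {0..} (killed_waiting A B (Suc n) \<omega>) * h (killed_waiting A B (Suc n) \<omega>) \<partial>M)
    = (\<Sum>j\<le>k. (\<integral>\<^sup>+\<omega>. indicator {0..} (killed_waiting A B n \<omega>)
          * ennreal (poisson_weight \<mu> (k - j) (A (Suc n) \<omega> + killed_waiting A B n \<omega>)) \<partial>M)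
        * (\<integral>\<^sup>+x. h x * ennreal (erlang_density j \<mu> x) \<partial>lborel))"
proof -
  let ?K = "killed_waiting A B n"
  let ?V = "\<lambda>\<omega>. if 0 \<le> ?K \<omega> then A (Suc n) \<omega> + ?K \<omega> else - 1"
  let ?B = "B (Suc (Suc n))"
  have "(\<integral>\<^sup>+\<omega>. indicator {0..} (killed_waiting A B (Suc n) \<omega>) * h (killed_waiting A B (Suc n) \<omega>) \<partial>M)
      = (\<integral>\<^sup>+\<omega>. (if 0 \<le> ?V \<omega> \<and> 0 < ?B \<omega> - ?V \<omega> then h (?B \<omega> - ?V \<omega>) else 0) \<partial>M)"
  proof (rule nn_integral_cong_AE)
    show "AE \<omega> in M. indicator {0..} (killed_waiting A B (Suc n) \<omega>) * h (killed_waiting A B (Suc n) \<omega>)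
        = (if 0 \<le> ?V \<omega> \<and> 0 < ?B \<omega> - ?V \<omega> then h (?B \<omega> - ?V \<omega>) else 0)"
      using A_nonneg[of "Suc n", simplified] by eventually_elim (simp add: Let_def diff_diff_eq)
  qed
  also have "\<dots> = (\<Sum>j\<le>k. (\<integral>\<^sup>+\<omega>. indicator {0..} (?V \<omega>) * ennreal (poisson_weight \<mu> (k - j) (?V \<omega>)) \<partial>M)
        * (\<integral>\<^sup>+x. h x * ennreal (erlang_density j \<mu> x) \<partial>lborel))"
    by (rule nn_integral_residual_service[OF indep_var_killed_waiting_B B_erlang rate_pos]) auto
  also have "(\<lambda>j. \<integral>\<^sup>+\<omega>. indicator {0..} (?V \<omega>) * ennreal (poisson_weight \<mu> (k - j) (?V \<omega>)) \<partial>M)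
      = (\<lambda>j. \<integral>\<^sup>+\<omega>. indicator {0..} (?K \<omega>) * ennreal (poisson_weight \<mu> (k - j) (A (Suc n) \<omega> + ?K \<omega>)) \<partial>M)"
  proof (intro ext nn_integral_cong_AE)
    fix j
    show "AE \<omega> in M. indicator {0..} (?V \<omega>) * ennreal (poisson_weight \<mu> (k - j) (?V \<omega>))
        = indicator {0..} (?K \<omega>) * ennreal (poisson_weight \<mu> (k - j) (A (Suc n) \<omega> + ?K \<omega>))"
      using A_nonneg[of "Suc n", simplified] by eventually_elim simp
  qed
  finally show ?thesis .
qed

text \<open>On the event that no waiting time has vanished, the law of the waiting time is a mixture of
  Erlang laws whose weights evolve by the sub-stochastic matrix of the p i j with i, j >= 1.\<close>
lemma nn_integral_killed_waiting:
  fixes h :: "real \<Rightarrow> ennreal"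
  assumes "h \<in> borel_measurable borel"
  shows "(\<integral>\<^sup>+\<omega>. indicator {0..} (killed_waiting A B (Suc n) \<omega>) * h (killed_waiting A B (Suc n) \<omega>) \<partial>M)
    = (\<Sum>j\<le>k. ennreal (phase_mass p k n j) * (\<integral>\<^sup>+x. h x * ennreal (erlang_density j \<mu> x) \<partial>lborel))"
  using assms
proof (induction n arbitrary: h)
  case 0
  \<comment> \<open>The process starts at 0, so the first threshold is \<open>A 1\<close> alone and
    its expected weights are the entries \<open>p 0 (Suc j)\<close>.\<close>
  show ?case
    unfolding nn_integral_killed_waiting_Suc[OF 0]
    by (simp add: nn_integral_poisson_weight p_0_eq)
next
  case (Suc n)
  let ?K = "killed_waiting A B (Suc n)"
  let ?E = "\<lambda>m. expectation (\<lambda>\<omega>. poisson_weight \<mu> m (A 1 \<omega>))"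
  let ?c = "\<lambda>i l. real ((i + l) choose i) / 2 ^ (i + l + 1)"
  have "(\<integral>\<^sup>+\<omega>. indicator {0..} (?K \<omega>) * ennreal (poisson_weight \<mu> (k - j) (A (Suc (Suc n)) \<omega> + ?K \<omega>)) \<partial>M)
      = ennreal (phase_mass p k (Suc n) j)" for j
  proof -
    have "(\<integral>\<^sup>+\<omega>. indicator {0..} (?K \<omega>) * ennreal (poisson_weight \<mu> (k - j) (A (Suc (Suc n)) \<omega> + ?K \<omega>)) \<partial>M)
        = (\<Sum>l\<le>k - j. (\<integral>\<^sup>+\<omega>. indicator {0..} (?K \<omega>) * ennreal (poisson_weight \<mu> l (?K \<omega>)) \<partial>M)
            * (\<integral>\<^sup>+\<omega>. ennreal (poisson_weight \<mu> (k - j - l) (A (Suc (Suc n)) \<omega>)) \<partial>M))"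
      using indep_var_killed_waiting_A A_nonneg rate_pos
      by (intro nn_integral_poisson_weight_add) (auto simp del: killed_waiting.simps)
    \<comment> \<open>The induction hypothesis is used with the Poisson weight of index
      \<open>l\<close> as \<open>h\<close>; its Erlang integrals are the constants
      \<open>?c i l\<close>.\<close>
    also have "\<dots> = (\<Sum>l\<le>k - j. (\<Sum>i\<le>k. ennreal (phase_mass p k n i) * ennreal (?c i l)) * ennreal (?E (k - j - l)))"
      by (subst Suc.IH) (simp_all add: nn_integral_poisson_weight_erlang rate_pos nn_integral_poisson_weight del: killed_waiting.simps)
    also have "\<dots> = ennreal (\<Sum>l\<le>k - j. (\<Sum>i\<le>k. phase_mass p k n i * ?c i l) * ?E (k - j - l))"
      by (intro sum_ennreal_mult_sum phase_mass_nonneg expectation_poisson_weight_nonneg) simp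
    \<comment> \<open>Summing over \<open>l\<close> first assembles the entry
      \<open>p (Suc i) (Suc j)\<close>.\<close>
    also have "(\<Sum>l\<le>k - j. (\<Sum>i\<le>k. phase_mass p k n i * ?c i l) * ?E (k - j - l))
        = (\<Sum>i\<le>k. phase_mass p k n i * (\<Sum>l\<le>k - j. ?c i l * ?E (k - j - l)))"
      unfolding sum_distrib_right sum_distrib_left by (subst sum.swap) (simp only: mult.assoc)
    finally show ?thesis
      by (simp only: phase_mass.simps p_Suc_eq)
  qed
  then show ?case
    unfolding nn_integral_killed_waiting_Suc[OF Suc.prems] by simp
qed

text \<open>The mixture formula with \<open>h = 1\<close>, since every Erlang density has integral
  1.\<close>

lemma prob_killed_waiting_nonneg:
  "prob {\<omega> \<in> space M. 0 \<le> killed_waiting A B (Suc n) \<omega>} = (\<Sum>j\<le>k. phase_mass p k n j)"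
proof -
  have [measurable]: "killed_waiting A B (Suc n) \<in> borel_measurable M"
    by (rule measurable_killed_waiting) (auto intro: A_meas B_meas)
  have "emeasure M {\<omega> \<in> space M. 0 \<le> killed_waiting A B (Suc n) \<omega>}
      = (\<integral>\<^sup>+\<omega>. indicator {\<omega> \<in> space M. 0 \<le> killed_waiting A B (Suc n) \<omega>} \<omega> \<partial>M)"
    by (subst nn_integral_indicator) measurable
  also have "\<dots> = (\<integral>\<^sup>+\<omega>. indicator {0..} (killed_waiting A B (Suc n) \<omega>) * 1 \<partial>M)"
    by (intro nn_integral_cong) (auto split: split_indicator)
  also have "\<dots> = ennreal (\<Sum>j\<le>k. phase_mass p k n j)"
    by (subst nn_integral_killed_waiting)
      (simp_all add: nn_integral_erlang_density_eq_1 rate_pos phase_mass_nonneg flip: sum_ennreal)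
  finally show ?thesis
    by (simp add: measure_def sum_nonneg phase_mass_nonneg)
qed

text \<open>The event is the difference of two nested survival events.\<close>

lemma prob_cycle_len_eq:
  "prob {\<omega> \<in> space M. cycle_len A B \<omega> = enat (Suc (Suc n))}
    = (\<Sum>j\<le>k. phase_mass p k n j) - (\<Sum>j\<le>k. phase_mass p k (Suc n) j)"
proof -
  have meas [measurable]: "killed_waiting A B m \<in> borel_measurable M" for m
    by (rule measurable_killed_waiting) (auto intro: A_meas B_meas)
  let ?alive = "\<lambda>m. {\<omega> \<in> space M. 0 \<le> killed_waiting A B m \<omega>}"
  have "{\<omega> \<in> space M. cycle_len A B \<omega> = enat (Suc (Suc n))} = ?alive (Suc n) - ?alive (Suc (Suc n))"
    unfolding cycle_len_eq_enat_Suc_iff by auto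
  also have "prob \<dots> = prob (?alive (Suc n)) - prob (?alive (Suc (Suc n)))"
  proof (rule finite_measure_Diff)
    show "?alive (Suc (Suc n)) \<subseteq> ?alive (Suc n)"
      unfolding killed_waiting_nonneg_iff by auto
  qed measurable
  finally show ?thesis by (simp only: prob_killed_waiting_nonneg)
qed

end

section \<open>Matrix form\<close>

text \<open>The phase masses at step \<open>n\<close> are the row vector \<open>q Q^n\<close>.
  Testing against arbitrary \<open>x\<close> lets the induction move one factor \<open>Q\<close>
  onto \<open>x\<close>.\<close>

lemma phase_mass_eq_scalar_prod:
  fixes p :: "nat \<Rightarrow> nat \<Rightarrow> real" and k :: nat
  defines "Q \<equiv> mat (Suc k) (Suc k) (\<lambda>(i, j). p (Suc i) (Suc j))"
  assumes "x \<in> carrier_vec (Suc k)"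
  shows "vec (Suc k) (\<lambda>j. p 0 (Suc j)) \<bullet> (Q ^\<^sub>m n *\<^sub>v x) = vec (Suc k) (phase_mass p k n) \<bullet> x"
  using assms(2)
proof (induction n arbitrary: x)
  case 0
  moreover have "phase_mass p k 0 = (\<lambda>j. p 0 (Suc j))" by auto
  ultimately show ?case by (simp add: Q_def)
next
  case (Suc n)
  have Q: "Q \<in> carrier_mat (Suc k) (Suc k)" by (simp add: Q_def)
  then have "Q ^\<^sub>m Suc n *\<^sub>v x = Q ^\<^sub>m n *\<^sub>v (Q *\<^sub>v x)"
    using Suc.prems by (simp add: assoc_mult_mat_vec[of _ "Suc k" "Suc k" _ "Suc k"] pow_carrier_mat)
  with Q Suc.prems have "vec (Suc k) (\<lambda>j. p 0 (Suc j)) \<bullet> (Q ^\<^sub>m Suc n *\<^sub>v x)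
      = vec (Suc k) (phase_mass p k n) \<bullet> (Q *\<^sub>v x)"
    by (simp add: Suc.IH)
  also have "\<dots> = (\<Sum>i<Suc k. phase_mass p k n i * (\<Sum>j<Suc k. p (Suc i) (Suc j) * x $ j))"
    using Suc.prems
    by (auto simp: scalar_prod_def Q_def atLeast0LessThan intro!: sum.cong)
  also have "\<dots> = (\<Sum>j<Suc k. (\<Sum>i\<le>k. phase_mass p k n i * p (Suc i) (Suc j)) * x $ j)"
    unfolding sum_distrib_left sum_distrib_right lessThan_Suc_atMost
    by (subst sum.swap) (simp only: mult.assoc)
  also have "\<dots> = vec (Suc k) (phase_mass p k (Suc n)) \<bullet> x"
    using Suc.prems by (auto simp: scalar_prod_def atLeast0LessThan intro!: sum.cong)
  finally show ?case .
qed

theorem theorem5p2: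
  fixes M :: "'a measure" and A B :: "nat \<Rightarrow> 'a \<Rightarrow> real"
    and N :: nat and \<mu> :: real and n :: nat
  assumes "prob_space M"
    and "N \<ge> 1" and "\<mu> > 0"
    and "\<And>k. k \<ge> 1 \<Longrightarrow> A k \<in> borel_measurable M"
    and "\<And>k. k \<ge> 1 \<Longrightarrow> AE \<omega> in M. A k \<omega> \<ge> 0"
    and "\<And>k. k \<ge> 1 \<Longrightarrow> distr M borel (A k) = distr M borel (A 1)"
    and "\<And>k. k \<ge> 1 \<Longrightarrow> distributed M lborel (B k) (erlang_density (N - 1) \<mu>)"
    and "prob_space.indep_vars M (\<lambda>_. borel)
           (\<lambda>i. case i of Inl k \<Rightarrow> A k | Inr k \<Rightarrow> B k)
           ({Inl k | k. k \<ge> 1} \<union> {Inr k | k. k \<ge> 1})"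
    and "n \<ge> 1"
  shows "let \<alpha> = (\<lambda>s. prob_space.expectation M (\<lambda>\<omega>. exp (- s * A 1 \<omega>)));
             p = trans_p \<alpha> \<mu> N;
             Q = mat N N (\<lambda>(i, j). p (i + 1) (j + 1));
             q = vec N (\<lambda>j. p 0 (j + 1));
             e = vec N (\<lambda>_. 1)
         in measure M {\<omega> \<in> space M. cycle_len A B \<omega> = enat (n + 1)}
            = q \<bullet> ((Q ^\<^sub>m (n - 1) * (1\<^sub>m N - Q)) *\<^sub>v e)"
proof -
  interpret prob_space M by fact
  interpret alternating_service M A B "N - 1" \<mu>
    by unfold_locales (fact assms)+
  obtain k where k: "N = Suc k" using \<open>N \<ge> 1\<close> by (cases N) auto
  \<comment> \<open>With \<open>n = m + 1\<close> the exponent \<open>n - 1\<close> is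
    \<open>m\<close> and the cycle length \<open>n + 1\<close> is \<open>m + 2\<close>, as in
    \<open>prob_cycle_len_eq\<close>.\<close>
  obtain m where m: "n = Suc m" using \<open>n \<ge> 1\<close> by (cases n) auto
  define p where "p = trans_p laplace \<mu> (Suc k)"
  define Q where "Q = mat (Suc k) (Suc k) (\<lambda>(i, j). p (Suc i) (Suc j))"
  define q where "q = vec (Suc k) (\<lambda>j. p 0 (Suc j))"
  define e :: "real vec" where "e = vec (Suc k) (\<lambda>_. 1)"
  have Q: "Q \<in> carrier_mat (Suc k) (Suc k)" and q: "q \<in> carrier_vec (Suc k)" and e: "e \<in> carrier_vec (Suc k)"
    by (auto simp: Q_def q_def e_def)
  have Qm: "Q ^\<^sub>m j \<in> carrier_mat (Suc k) (Suc k)" for j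
    using Q by (rule pow_carrier_mat)
  have mass: "q \<bullet> (Q ^\<^sub>m j *\<^sub>v e) = (\<Sum>i\<le>k. phase_mass p k j i)" for j
    unfolding q_def Q_def phase_mass_eq_scalar_prod[OF e]
    by (simp add: e_def scalar_prod_def atLeast0LessThan lessThan_Suc_atMost del: sum.lessThan_Suc)
  \<comment> \<open>The factor \<open>I - Q\<close> produces the difference of two successive
    survival probabilities.\<close>
  have "Q ^\<^sub>m m * (1\<^sub>m (Suc k) - Q) = Q ^\<^sub>m m - Q ^\<^sub>m Suc m"
    using Q Qm[of m] by (subst mult_minus_distrib_mat[of _ "Suc k" "Suc k"]) simp_all
  then have "q \<bullet> ((Q ^\<^sub>m m * (1\<^sub>m (Suc k) - Q)) *\<^sub>v e) = q \<bullet> (Q ^\<^sub>m m *\<^sub>v e - Q ^\<^sub>m Suc m *\<^sub>v e)"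
    using Qm[of m] Qm[of "Suc m"] e by (simp add: minus_mult_distrib_mat_vec[of _ "Suc k" "Suc k"] del: pow_mat.simps)
  also have "\<dots> = q \<bullet> (Q ^\<^sub>m m *\<^sub>v e) - q \<bullet> (Q ^\<^sub>m Suc m *\<^sub>v e)"
    using Qm[of m] Qm[of "Suc m"] q e by (intro scalar_prod_minus_distrib[of _ "Suc k"]) (auto simp del: pow_mat.simps)
  also have "\<dots> = prob {\<omega> \<in> space M. cycle_len A B \<omega> = enat (Suc (Suc m))}"
    using prob_cycle_len_eq[of m] by (simp only: mass k diff_Suc_1 p_def)
  finally show ?thesis
    by (simp add: Let_def k m Q_def q_def e_def p_def laplace_def[abs_def] del: pow_mat.simps)
qed

end
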